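(* Let $R$ be a commutative ring, let $M$ be an $R$-module and let $\mathfrak{p} \in \mathrm{sK}_R(M)$. Then there is some maximal element $P$ of $\mathrm{sK}_R(M)$ (with respect to inclusion) such that $\mathfrak{p} \subseteq P$.
   Context: All rings are commutative with unity and not necessarily Noetherian. For an $R$-module $M$, the set $\mathrm{sK}_R(M)$ of strong Krull primes of $M$ is the set of all $\mathfrak{p} \in \mathrm{Spec}\, R$ such that for every finitely generated ideal $I$ of $R$ with $I \subseteq \mathfrak{p}$ there is an element $z \in M$ with $I \subseteq \mathrm{ann}_R(z) \subseteq \mathfrak{p}$. *)

theory Defs
  imports "HOL-Algebra.Module" "HOL-Algebra.Ideal"
begin

definition annihilator ::
  "('a, 'm) ring_scheme \<Rightarrow> ('a, 'b, 'n) module_scheme \<Rightarrow> 'b \<Rightarrow> 'a set"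
  where "annihilator R M z = {r \<in> carrier R. r \<odot>\<^bsub>M\<^esub> z = \<zero>\<^bsub>M\<^esub>}"

definition fg_ideal :: "'a set \<Rightarrow> ('a, 'm) ring_scheme \<Rightarrow> bool"
  where "fg_ideal I R \<longleftrightarrow> (\<exists>S. finite S \<and> S \<subseteq> carrier R \<and> I = genideal R S)"

definition strong_krull_primes ::
  "('a, 'm) ring_scheme \<Rightarrow> ('a, 'b, 'n) module_scheme \<Rightarrow> 'a set set"
  where "strong_krull_primes R M =
    {p. primeideal p R \<and>
        (\<forall>I. fg_ideal I R \<and> I \<subseteq> p \<longrightarrow>
             (\<exists>z \<in> carrier M. I \<subseteq> annihilator R M z \<and> annihilator R M z \<subseteq> p))}"

end

(* Defs comes last in the imports so that the name module denotes the locale of HOL-Algebra, not the one of HOL.Modules. *)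
theory Submission
  imports "HOL-Algebra.Ring_Divisibility" Defs
begin

text \<open>Zorn's lemma is applied to the strong Krull primes containing \<open>p\<close>, with
  unions as upper bounds of nonempty chains. Such a union is prime by
  \<open>chain_Union_primeideal\<close>. It is again a strong Krull prime by
  \<open>chain_Union_strong_krull_primes\<close>, because the defining condition tests one finitely
  generated ideal at a time, and such an ideal inside the union already lies in one member of the
  chain.\<close>

lemma (in ring) chain_Union_primeideal:
  assumes "C \<noteq> {}" and "subset.chain {I. primeideal I R} C"
  shows "primeideal (\<Union>C) R"
proof -
  have prime: "primeideal I R" if "I \<in> C" for I
    using assms(2) that by (auto simp: subset.chain_def)
  have "subset.chain {I. ideal I R} C"
    using assms(2) by (auto simp: subset.chain_def primeideal_def)
  then have "ideal (\<Union>C) R"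
    using chain_Union_is_ideal[of C] assms(1) by simp
  moreover have "cring R"
    using assms(1) prime by (auto simp: primeideal_def)
  \<comment> \<open>For ideals, properness means omitting \<one>, a condition on a single element,
    so it passes from the members to their union.\<close>
  moreover have "\<one> \<notin> \<Union>C"
  proof
    assume "\<one> \<in> \<Union>C"
    then obtain I where "I \<in> C" "\<one> \<in> I"
      by blast
    then interpret primeideal I R
      using prime by blast
    show False
      using one_imp_carrier[OF \<open>\<one> \<in> I\<close>] I_notcarr by simp
  qed
  then have "carrier R \<noteq> \<Union>C"
    by auto
  moreover have "a \<in> \<Union>C \<or> b \<in> \<Union>C"
    if "a \<in> carrier R" "b \<in> carrier R" "a \<otimes> b \<in> \<Union>C" for a b
    using that primeideal.I_prime[OF prime] by blast
  ultimately show ?thesis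
    by (rule primeidealI)
qed

text \<open>Finite generation is essential here: an arbitrary ideal inside \<Union>C need not lie in
  a single member of \<open>C\<close>.\<close>

lemma (in module) chain_Union_strong_krull_primes:
  assumes "C \<noteq> {}" and chain: "subset.chain (strong_krull_primes R M) C"
  shows "\<Union>C \<in> strong_krull_primes R M"
proof -
  have sK: "C \<subseteq> strong_krull_primes R M"
    using chain by (simp add: subset.chain_def)
  have "subset.chain {I. primeideal I R} C"
    using chain by (auto simp: subset.chain_def strong_krull_primes_def)
  then have prime: "primeideal (\<Union>C) R"
    using assms(1) R.chain_Union_primeideal by blast
  have "\<exists>z \<in> carrier M. I \<subseteq> annihilator R M z \<and> annihilator R M z \<subseteq> \<Union>C"
    if "fg_ideal I R" "I \<subseteq> \<Union>C" for I
  proof -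
    obtain S where S: "finite S" "S \<subseteq> carrier R" "I = genideal R S"
      using \<open>fg_ideal I R\<close> by (auto simp: fg_ideal_def)
    have "S \<subseteq> \<Union>C"
      using R.genideal_self[OF S(2)] S(3) \<open>I \<subseteq> \<Union>C\<close> by blast
    \<comment> \<open>Each of the finitely many generators lies in some member of \<open>C\<close>;
      the largest of these members contains them all, hence the ideal \<open>I\<close> that they
      generate.\<close>
    then obtain q where q: "q \<in> C" "S \<subseteq> q"
      using finite_subset_Union_chain[OF S(1) _ assms(1) chain] by blast
    then have "ideal q R"
      using sK by (auto simp: strong_krull_primes_def primeideal_def)
    then have "I \<subseteq> q"
      using R.genideal_minimal q(2) S(3) by blast
    \<comment> \<open>The witness for \<open>q\<close> also serves for the union, since its
      annihilator stays inside \<open>q\<close> \<subseteq> \<Union>C.\<close>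
    then obtain z where "z \<in> carrier M" "I \<subseteq> annihilator R M z" "annihilator R M z \<subseteq> q"
      using sK q(1) \<open>fg_ideal I R\<close> unfolding strong_krull_primes_def by blast
    then show ?thesis
      using q(1) by blast
  qed
  with prime show ?thesis
    by (simp add: strong_krull_primes_def)
qed

theorem lemma2p6:
  fixes R :: "('a, 'm) ring_scheme" and M :: "('a, 'b, 'n) module_scheme"
  assumes "module R M"
    and "p \<in> strong_krull_primes R M"
  shows "\<exists>P \<in> strong_krull_primes R M.
           (\<forall>Q \<in> strong_krull_primes R M. P \<subseteq> Q \<longrightarrow> Q = P) \<and> p \<subseteq> P"
proof -
  \<comment> \<open>Restricting to the primes above \<open>p\<close> forces the maximal element to
    contain \<open>p\<close>; the set is nonempty because \<open>p\<close> belongs to it.\<close>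
  let ?A = "{q \<in> strong_krull_primes R M. p \<subseteq> q}"
  have "\<exists>P \<in> ?A. \<forall>Q \<in> ?A. P \<subseteq> Q \<longrightarrow> Q = P"
  proof (rule subset_Zorn_nonempty)
    show "?A \<noteq> {}"
      using assms(2) by blast
  next
    fix C
    assume "C \<noteq> {}" and chain: "subset.chain ?A C"
    then have "subset.chain (strong_krull_primes R M) C"
      by (auto simp: subset.chain_def)
    then have "\<Union>C \<in> strong_krull_primes R M"
      by (rule module.chain_Union_strong_krull_primes[OF assms(1) \<open>C \<noteq> {}\<close>])
    moreover have "p \<subseteq> \<Union>C"
      using \<open>C \<noteq> {}\<close> chain by (fastforce simp: subset.chain_def)
    ultimately show "\<Union>C \<in> ?A"
      by simp
  qed
  then obtain P where P: "P \<in> strong_krull_primes R M" "p \<subseteq> P"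
    and max: "\<And>Q. Q \<in> ?A \<Longrightarrow> P \<subseteq> Q \<Longrightarrow> Q = P"
    by auto
  \<comment> \<open>Maximality in \<open>?A\<close> is maximality among all strong Krull primes,
    because any \<open>Q\<close> above \<open>P\<close> contains \<open>p\<close> and so lies in
    \<open>?A\<close>.\<close>
  have "Q = P" if "Q \<in> strong_krull_primes R M" "P \<subseteq> Q" for Q
    using max that order_trans[OF P(2) that(2)] by simp
  with P show ?thesis
    by auto
qed

end
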